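(* Let $G,H\in\mathbb{F}_q[x]$ be nonzero. Let $\bar H$ denote the largest square-free monic divisor of $H$ (the product of the distinct monic irreducible divisors of $H$) and $H^*=H/\bar H$; define $\bar G$ and $G^*=G/\bar G$ likewise. Then $$\frac{\mu(\bar H)\,\eta(GH^*,H)}{|H^*|}=\frac{\mu(\bar G)\,\eta(HG^*,G)}{|G^*|}.$$
   Context: Let $\mathbb{F}_q$ be a finite field with $q$ elements and fix a non-trivial homomorphism $\lambda:(\mathbb{F}_q,+)\to\mathbb{C}^*$. For nonzero $M\in\mathbb{F}_q[x]$ of degree $m\ge1$ and $A\in\mathbb{F}_q[x]$, let $t_M(A)$ be the coefficient of $x^{m-1}$ in the remainder of $A$ on division by $M$ (if $m=0$, $t_M(A)=0$), and $E(G,M)(A)=\lambda(t_M(GA))$. For nonzero $H$, the polynomial Ramanujan sum is $\eta(G,H)=\sum_{D}E(G,H)(D)$, where $D$ runs over a complete residue system modulo $H$ with $\gcd(D,H)=1$. $|A|=q^{\deg A}$. The Möbius function $\mu$ on $\mathbb{F}_q[x]$: $\mu(A)=0$ if $A=0$ or $P^2\mid A$ for some irreducible $P$, otherwise $\mu(A)=(-1)^t$ with $t$ the number of distinct monic irreducible factors of $A$. *)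

theory Defs
  imports "HOL-Computational_Algebra.Computational_Algebra" "HOL-Library.Cardinality"
begin

definition nontrivial_additive_character :: "('a::field \<Rightarrow> complex) \<Rightarrow> bool" where
  "nontrivial_additive_character lam \<longleftrightarrow>
     (\<forall>a b. lam (a + b) = lam a * lam b) \<and> (\<forall>a. lam a \<noteq> 0) \<and> (\<exists>a. lam a \<noteq> 1)"

definition t_coeff :: "'a::field poly \<Rightarrow> 'a poly \<Rightarrow> 'a" where
  "t_coeff M A = (if degree M = 0 then 0 else coeff (A mod M) (degree M - 1))"

definition E_char :: "('a::field \<Rightarrow> complex) \<Rightarrow> 'a poly \<Rightarrow> 'a poly \<Rightarrow> 'a poly \<Rightarrow> complex" where
  "E_char lam G M A = lam (t_coeff M (G * A))"

text \<open>
  The complete residue system modulo \<open>H\<close> used here is the set of remainders on division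
  by \<open>H\<close>; the lemma \<open>ramanujan_sum_eq\<close> below shows that any other choice gives the same sum.
\<close>

definition ramanujan_sum :: "('a::{field,finite} \<Rightarrow> complex) \<Rightarrow> 'a poly \<Rightarrow> 'a poly \<Rightarrow> complex" where
  "ramanujan_sum lam G H = (\<Sum>D | D mod H = D \<and> coprime D H. E_char lam G H D)"

definition poly_abs :: "'a::{field,finite} poly \<Rightarrow> nat" where
  "poly_abs A = (if A = 0 then 0 else CARD('a) ^ degree A)"

definition monic_irreducible_divisors :: "'a::field poly \<Rightarrow> 'a poly set" where
  "monic_irreducible_divisors A = {P. irreducible P \<and> lead_coeff P = 1 \<and> P dvd A}"

definition poly_moebius :: "'a::field poly \<Rightarrow> int" where
  "poly_moebius A =
     (if A = 0 \<or> (\<exists>P. irreducible P \<and> P ^ 2 dvd A) then 0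
      else (-1) ^ card (monic_irreducible_divisors A))"

definition squarefree_kernel :: "'a::field poly \<Rightarrow> 'a poly" where
  "squarefree_kernel A = \<Prod>(monic_irreducible_divisors A)"

definition kernel_cofactor :: "'a::field poly \<Rightarrow> 'a poly" where
  "kernel_cofactor A = A div squarefree_kernel A"


definition complete_residue_system :: "'a::field poly set \<Rightarrow> 'a poly \<Rightarrow> bool" where
  "complete_residue_system S H \<longleftrightarrow> (\<forall>A. \<exists>!D. D \<in> S \<and> D mod H = A mod H)"

lemma coprime_mod_poly_iff: "coprime (D mod H) H \<longleftrightarrow> coprime D (H :: 'a::field poly)"
  by (simp add: coprime_def dvd_mod_iff cong: conj_cong)
     (metis dvd_mod_iff)

lemma E_char_mod: "E_char lam G H (D mod H) = E_char lam G H D"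
  by (simp add: E_char_def t_coeff_def mod_mult_right_eq)

lemma ramanujan_sum_eq:
  assumes "complete_residue_system S H"
  shows "ramanujan_sum lam G H = (\<Sum>D | D \<in> S \<and> coprime D H. E_char lam G H D)"
proof -
  have "bij_betw (\<lambda>D. D mod H) {D. D \<in> S \<and> coprime D H} {D. D mod H = D \<and> coprime D H}"
    unfolding bij_betw_def
  proof
    show "inj_on (\<lambda>D. D mod H) {D. D \<in> S \<and> coprime D H}"
      using assms unfolding complete_residue_system_def inj_on_def by blast
    show "(\<lambda>D. D mod H) ` {D. D \<in> S \<and> coprime D H} = {D. D mod H = D \<and> coprime D H}"
    proof (intro equalityI subsetI)
      fix A assume A: "A \<in> {D. D mod H = D \<and> coprime D H}"
      obtain D where "D \<in> S" "D mod H = A mod H"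
        using assms unfolding complete_residue_system_def by blast
      with A have "D \<in> S" "coprime D H" "A = D mod H"
        using coprime_mod_poly_iff[of D H] by auto
      thus "A \<in> (\<lambda>D. D mod H) ` {D. D \<in> S \<and> coprime D H}" by blast
    qed (auto simp: coprime_mod_poly_iff)
  qed
  from sum.reindex_bij_betw[OF this, of "E_char lam G H"] show ?thesis
    by (simp add: ramanujan_sum_def E_char_mod)
qed


lemma finite_monic_irreducible_divisors:
  assumes "A \<noteq> (0 :: 'a::{field,finite} poly)"
  shows "finite (monic_irreducible_divisors A)"
proof (rule finite_subset)
  have "P \<in> Poly ` {xs. set xs \<subseteq> UNIV \<and> length xs \<le> Suc (degree A)}"
    if "P dvd A" for P
  proof (rule image_eqI[of _ _ "coeffs P"])
    show "coeffs P \<in> {xs. set xs \<subseteq> UNIV \<and> length xs \<le> Suc (degree A)}"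
      using dvd_imp_degree_le[OF that assms] by (cases "P = 0") (auto simp: length_coeffs)
  qed simp
  thus "monic_irreducible_divisors A \<subseteq> Poly ` {xs. set xs \<subseteq> UNIV \<and> length xs \<le> Suc (degree A)}"
    unfolding monic_irreducible_divisors_def by blast
  show "finite (Poly ` {xs :: 'a list. set xs \<subseteq> UNIV \<and> length xs \<le> Suc (degree A)})"
    by (intro finite_imageI finite_lists_length_le) simp
qed

lemma monic_irreducible_dvd_eq:
  fixes P Q :: "'a::field poly"
  assumes "irreducible P" "irreducible Q" "lead_coeff P = 1" "lead_coeff Q = 1" "P dvd Q"
  shows "P = Q"
proof -
  obtain C where C: "Q = P * C" using assms(5) by (elim dvdE)
  with assms have "C dvd 1" by (auto simp: irreducible_def)
  then obtain c where "C = [:c:]" by (auto simp: is_unit_poly_iff)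
  with C assms show ?thesis by (auto split: if_splits)
qed

lemma monic_irreducible_not_dvd_prod:
  fixes P :: "'a::field poly"
  assumes "finite S" "\<And>Q. Q \<in> insert P S \<Longrightarrow> irreducible Q \<and> lead_coeff Q = 1" "P \<notin> S"
  shows "\<not> P dvd \<Prod>S"
  using assms
proof (induction S rule: finite_induct)
  case empty
  thus ?case by (auto simp: irreducible_def)
next
  case (insert Q S)
  have "prime_elem P" using insert.prems by (intro field_poly_irreducible_imp_prime) auto
  moreover have "\<not> P dvd Q" using monic_irreducible_dvd_eq[of P Q] insert.prems by auto
  ultimately show ?case using insert by (auto simp: prime_elem_dvd_mult_iff)
qed

lemma monic_irreducible_divisor_exists:
  fixes A :: "'a::field poly"
  assumes "A \<noteq> 0" "\<not> A dvd 1"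
  obtains P where "irreducible P" "lead_coeff P = 1" "P dvd A"
proof -
  from assms(2) have "\<exists>P. irreducible P \<and> P dvd A" using assms(1)
  proof (induction "degree A" arbitrary: A rule: less_induct)
    case less
    show ?case
    proof (cases "irreducible A")
      case False
      then obtain B C where BC: "A = B * C" "\<not> B dvd 1" "\<not> C dvd 1"
        using less.prems by (auto simp: irreducible_def)
      with less.prems have "B \<noteq> 0" "C \<noteq> 0" by auto
      hence "degree C \<noteq> 0" using BC(3) by (simp add: is_unit_iff_degree)
      hence "degree B < degree A"
        using BC \<open>B \<noteq> 0\<close> \<open>C \<noteq> 0\<close> by (simp add: degree_mult_eq)
      from less.hyps[OF this BC(2) \<open>B \<noteq> 0\<close>] show ?thesis
        using BC(1) by (auto intro: dvd_mult2)
    qed auto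
  qed
  then obtain P where P: "irreducible P" "P dvd A" by blast
  define c where "c = inverse (lead_coeff P)"
  have c: "c \<noteq> 0" using P by (auto simp: c_def)
  have "irreducible ([:c:] * P)"
    by (subst irreducible_mult_unit_left) (use c P in \<open>auto simp: is_unit_const_poly_iff dvd_field_iff\<close>)
  moreover have "lead_coeff (smult c P) = 1" using c by (auto simp: c_def)
  moreover have "smult c P dvd A" using c P by (simp add: smult_dvd_iff)
  ultimately show ?thesis using that[of "smult c P"] by simp
qed

lemma prod_irreducibles_dvd:
  fixes S :: "'a::field poly set"
  assumes "finite S" "\<And>P. P \<in> S \<Longrightarrow> irreducible P \<and> lead_coeff P = 1 \<and> P dvd A"
  shows "\<Prod>S dvd A"
  using assms
proof (induction S rule: finite_induct)
  case (insert P S)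
  then obtain B where B: "A = \<Prod>S * B" by (auto elim!: dvdE)
  have pr: "prime_elem P"
    using insert.prems by (intro field_poly_irreducible_imp_prime) auto
  have "\<not> P dvd \<Prod>S"
    using insert by (intro monic_irreducible_not_dvd_prod) auto
  moreover have "P dvd \<Prod>S * B" using insert.prems[of P] B by auto
  ultimately have "P dvd B" using pr by (auto simp: prime_elem_dvd_mult_iff)
  thus ?case using B insert.hyps by (auto simp: mult.commute intro: mult_dvd_mono)
qed auto

text \<open>
  The next four lemmas show that the product of the distinct monic irreducible divisors is
  indeed the largest square-free monic divisor.
\<close>

lemma lead_coeff_squarefree_kernel: "lead_coeff (squarefree_kernel A) = 1"
  by (simp add: squarefree_kernel_def lead_coeff_prod monic_irreducible_divisors_def)

lemma squarefree_kernel_dvd: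
  assumes "A \<noteq> (0 :: 'a::{field,finite} poly)"
  shows "squarefree_kernel A dvd A"
  unfolding squarefree_kernel_def
  by (rule prod_irreducibles_dvd[OF finite_monic_irreducible_divisors[OF assms]])
     (auto simp: monic_irreducible_divisors_def)

lemma squarefree_squarefree_kernel:
  assumes A: "A \<noteq> (0 :: 'a::{field,finite} poly)"
  shows "squarefree (squarefree_kernel A)"
proof (rule squarefreeI, rule ccontr)
  let ?S = "monic_irreducible_divisors A"
  fix x assume x: "x ^ 2 dvd squarefree_kernel A" "\<not> x dvd 1"
  have nz: "squarefree_kernel A \<noteq> 0" using squarefree_kernel_dvd[OF A] A by auto
  with x have "x \<noteq> 0" by auto
  then obtain P where P: "irreducible P" "lead_coeff P = 1" "P dvd x"
    using monic_irreducible_divisor_exists x(2) by blast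
  have PP: "P * P dvd squarefree_kernel A"
    using P(3) x(1) by (metis dvd_trans mult_dvd_mono power2_eq_square)
  hence "P dvd A" using squarefree_kernel_dvd[OF A] by (metis dvd_mult_left dvd_trans)
  with P have "P \<in> ?S" by (simp add: monic_irreducible_divisors_def)
  hence "squarefree_kernel A = P * \<Prod>(?S - {P})"
    unfolding squarefree_kernel_def
    by (rule prod.remove[OF finite_monic_irreducible_divisors[OF A]])
  with PP P have "P dvd \<Prod>(?S - {P})" by auto
  moreover have "\<not> P dvd \<Prod>(?S - {P})"
    using P finite_monic_irreducible_divisors[OF A]
    by (intro monic_irreducible_not_dvd_prod) (auto simp: monic_irreducible_divisors_def)
  ultimately show False by blast
qed

lemma squarefree_kernel_greatest:
  assumes A: "A \<noteq> (0 :: 'a::{field,finite} poly)" and B: "squarefree B" "B dvd A"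
  shows "B dvd squarefree_kernel A"
proof -
  have B0: "B \<noteq> 0" using A B by auto
  obtain C where C: "B = squarefree_kernel B * C" using squarefree_kernel_dvd[OF B0] by (elim dvdE)
  have "C dvd 1"
  proof (rule ccontr)
    assume "\<not> C dvd 1"
    moreover have "C \<noteq> 0" using C B0 by (metis mult_zero_right)
    ultimately obtain P where P: "irreducible P" "lead_coeff P = 1" "P dvd C"
      using monic_irreducible_divisor_exists by blast
    hence "P dvd B" using C by (metis dvd_mult)
    hence "P \<in> monic_irreducible_divisors B"
      using P by (simp add: monic_irreducible_divisors_def)
    hence "P dvd squarefree_kernel B"
      unfolding squarefree_kernel_def
      using dvd_prodI[OF finite_monic_irreducible_divisors[OF B0], of P "\<lambda>x. x"] by simp
    hence "P ^ 2 dvd B" using P C by (metis mult_dvd_mono power2_eq_square)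
    with B(1) have "P dvd 1" by (auto simp: squarefree_def)
    with P show False by (auto simp: irreducible_def)
  qed
  hence "B dvd squarefree_kernel B" using C by (metis dvd_refl mult_unit_dvd_iff)
  also have "squarefree_kernel B dvd squarefree_kernel A"
    unfolding squarefree_kernel_def
    by (rule prod_dvd_prod_subset[OF finite_monic_irreducible_divisors[OF A]])
       (use B in \<open>auto simp: monic_irreducible_divisors_def intro: dvd_trans\<close>)
  finally show ?thesis .
qed

end

theory Submission
  imports Defs
begin

text \<open>
  Both sides equal \<open>\<Prod>(1 - |P|)\<close> over the monic irreducible common divisors \<open>P\<close> of \<open>G\<close> and
  \<open>H\<close>, which is symmetric in \<open>G\<close> and \<open>H\<close>. Since \<open>t\<^sub>H(H\<^sup>* X)\<close> is \<open>t\<close> modulo the kernel of \<open>H\<close>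
  up to the leading coefficient of \<open>H\<^sup>*\<close>, the sum modulo \<open>H\<close> is \<open>|H\<^sup>*|\<close> times a sum modulo the kernel.
  For an irreducible \<open>P\<close> not dividing \<open>N\<close>, passing from the modulus \<open>N\<close> to \<open>N P\<close> multiplies the sum
  by \<open>|P| - 1\<close> if \<open>P\<close> divides \<open>G\<close> and by \<open>-1\<close> otherwise.
\<close>

section \<open>Residues and coprimality of polynomials over a field\<close>

lemma mod_poly_eq_self_iff:
  fixes D M :: "'a::field poly"
  assumes "M \<noteq> 0"
  shows "D mod M = D \<longleftrightarrow> D = 0 \<or> degree D < degree M"
  using degree_mod_less[OF assms, of D] mod_poly_less[of D M] by auto

text \<open>A common divisor that is not a unit is nonzero because \<open>N\<close> is, so it has an
  irreducible factor. This reduces coprimality to prime divisors.\<close>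

lemma coprime_poly_iff_no_irreducible:
  fixes A N :: "'a::field poly"
  assumes "N \<noteq> 0"
  shows "coprime A N \<longleftrightarrow> (\<forall>P. irreducible P \<longrightarrow> P dvd A \<longrightarrow> \<not> P dvd N)"
proof
  assume *: "\<forall>P. irreducible P \<longrightarrow> P dvd A \<longrightarrow> \<not> P dvd N"
  show "coprime A N"
  proof (rule coprimeI, rule ccontr)
    fix C assume C: "C dvd A" "C dvd N" "\<not> C dvd 1"
    hence "C \<noteq> 0" using assms by auto
    then obtain P where "irreducible P" "P dvd C"
      using C(3) monic_irreducible_divisor_exists by blast
    with * C show False by (blast intro: dvd_trans)
  qed
qed (auto simp: irreducible_def dest: coprime_common_divisor)

lemma coprime_mult_left_poly_iff:
  fixes A B N :: "'a::field poly"
  assumes "N \<noteq> 0"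
  shows "coprime (A * B) N \<longleftrightarrow> coprime A N \<and> coprime B N"
  using prime_elem_dvd_mult_iff[OF field_poly_irreducible_imp_prime]
  unfolding coprime_poly_iff_no_irreducible[OF assms] by blast

lemma coprime_irreducible_left_iff:
  fixes P N :: "'a::field poly"
  assumes "irreducible P" "N \<noteq> 0"
  shows "coprime P N \<longleftrightarrow> \<not> P dvd N"
proof -
  have "P dvd Q" if "irreducible Q" "Q dvd P" for Q
    using that assms(1) by (metis irreducibleD' irreducible_not_unit)
  thus ?thesis
    using assms unfolding coprime_poly_iff_no_irreducible[OF assms(2)] by (meson dvd_refl dvd_trans)
qed

section \<open>Counting and splitting residues\<close>

text \<open>Induction on \<open>n\<close>, splitting off the constant coefficient. Vanishing
  coefficients are used in place of a degree bound so that neither the zero polynomial nor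
  \<open>n = 0\<close> is exceptional.\<close>

lemma finite_card_poly_coeff_bounded:
  "finite {p :: 'a::{field,finite} poly. \<forall>i\<ge>n. coeff p i = 0} \<and>
   card {p :: 'a poly. \<forall>i\<ge>n. coeff p i = 0} = CARD('a) ^ n"
proof (induction n)
  case 0
  have "{p :: 'a poly. \<forall>i\<ge>0. coeff p i = 0} = {0}" by (auto simp: poly_eq_iff)
  thus ?case by simp
next
  case (Suc n)
  let ?S = "\<lambda>n. {p :: 'a poly. \<forall>i\<ge>n. coeff p i = 0}"
  have eq: "?S (Suc n) = (\<lambda>(a, p). pCons a p) ` (UNIV \<times> ?S n)"
  proof (intro equalityI subsetI)
    fix p assume p: "p \<in> ?S (Suc n)"
    obtain a q where q: "p = pCons a q" by (cases p)
    have "coeff q i = 0" if "i \<ge> n" for i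
      using p that by (auto simp: q coeff_pCons dest!: spec[of _ "Suc i"])
    with q show "p \<in> (\<lambda>(a, p). pCons a p) ` (UNIV \<times> ?S n)" by force
  qed (auto simp: coeff_pCons split: nat.splits)
  have "inj_on (\<lambda>(a, p). pCons a p) (UNIV \<times> ?S n)" by (auto simp: inj_on_def)
  with Suc show ?case unfolding eq by (simp add: card_image card_cartesian_product)
qed

lemma residues_eq_coeff_bounded:
  fixes M :: "'a::field poly"
  assumes "M \<noteq> 0"
  shows "{D. D mod M = D} = {p. \<forall>i\<ge>degree M. coeff p i = 0}"
proof -
  have "D = 0 \<or> degree D < degree M \<longleftrightarrow> (\<forall>i\<ge>degree M. coeff D i = 0)" for D
    by (metis coeff_0 coeff_eq_0 leading_coeff_neq_0 not_le order_less_le_trans)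
  thus ?thesis unfolding mod_poly_eq_self_iff[OF assms] by blast
qed

lemma finite_residues:
  fixes M :: "'a::{field,finite} poly"
  assumes "M \<noteq> 0"
  shows "finite {D. D mod M = D}"
  using finite_card_poly_coeff_bounded[of "degree M", where 'a = 'a] by (simp add: residues_eq_coeff_bounded[OF assms])

lemma card_residues:
  fixes M :: "'a::{field,finite} poly"
  assumes "M \<noteq> 0"
  shows "card {D. D mod M = D} = poly_abs M"
  using finite_card_poly_coeff_bounded[of "degree M", where 'a = 'a] assms
  by (simp add: residues_eq_coeff_bounded poly_abs_def)

text \<open>For \<open>B\<close> nonzero, \<open>D\<close> has smaller degree than
  \<open>N * B\<close> or is zero, so it cannot cancel the leading term and the degree of the sum is
  that of \<open>N * B\<close>.\<close>

lemma residues_mult_iff: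
  fixes N P D B :: "'a::field poly"
  assumes "N \<noteq> 0" "P \<noteq> 0" "D mod N = D"
  shows "(D + N * B) mod (N * P) = D + N * B \<longleftrightarrow> B mod P = B"
proof (cases "B = 0")
  case True
  have "D = 0 \<or> degree D < degree N + degree P"
    using assms by (auto simp: mod_poly_eq_self_iff)
  thus ?thesis using True assms by (auto simp: mod_poly_eq_self_iff degree_mult_eq)
next
  case False
  have deg: "degree (N * B) = degree N + degree B" using assms False by (simp add: degree_mult_eq)
  have D: "D = 0 \<or> degree D < degree N" using assms by (simp add: mod_poly_eq_self_iff)
  have "degree (D + N * B) = degree N + degree B"
    using D deg by (cases "D = 0") (auto simp: degree_add_eq_right)
  moreover have "D + N * B \<noteq> 0"
  proof
    assume "D + N * B = 0"
    hence "D = - (N * B)" by (simp add: eq_neg_iff_add_eq_0)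
    with D deg assms False show False by auto
  qed
  ultimately show ?thesis using assms False by (simp add: mod_poly_eq_self_iff degree_mult_eq)
qed

text \<open>Division with remainder by \<open>N\<close> writes each residue modulo
  \<open>N * P\<close> uniquely as \<open>D + N * B\<close>. Coprimality to \<open>N\<close> only
  sees \<open>D\<close>. Here \<open>P\<close> is any nonzero polynomial: it will be an irreducible
  in one use and the cofactor of the kernel in another.\<close>

lemma sum_residues_mult:
  fixes N P :: "'a::{field,finite} poly" and f :: "'a poly \<Rightarrow> complex"
  assumes "N \<noteq> 0" "P \<noteq> 0"
  shows "(\<Sum>D | D mod (N * P) = D \<and> coprime D N. f D) =
         (\<Sum>D | D mod N = D \<and> coprime D N. \<Sum>B | B mod P = B. f (D + N * B))"
proof -
  let ?g = "\<lambda>(D, B). D + N * B"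
  have cop: "coprime (D + N * B) N \<longleftrightarrow> coprime D N" for D B
    by (metis coprime_mod_poly_iff mod_mult_self2)
  have "bij_betw ?g ({D. D mod N = D \<and> coprime D N} \<times> {B. B mod P = B})
          {D. D mod (N * P) = D \<and> coprime D N}"
  proof (rule bij_betw_byWitness[where f' = "\<lambda>D. (D mod N, D div N)"])
    show "\<forall>a\<in>{D. D mod N = D \<and> coprime D N} \<times> {B. B mod P = B}.
            (\<lambda>D. (D mod N, D div N)) (?g a) = a"
    proof -
      have "D div N = 0" if "D mod N = D" for D
        using that by (metis assms(1) add_cancel_left_left div_mult_mod_eq mult_eq_0_iff)
      thus ?thesis using assms by auto
    qed
    show "\<forall>D\<in>{D. D mod (N * P) = D \<and> coprime D N}. ?g (D mod N, D div N) = D"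
      by (simp add: mod_mult_div_eq)
    show "?g ` ({D. D mod N = D \<and> coprime D N} \<times> {B. B mod P = B})
            \<subseteq> {D. D mod (N * P) = D \<and> coprime D N}"
      using assms by (auto simp: cop residues_mult_iff)
    show "(\<lambda>D. (D mod N, D div N)) ` {D. D mod (N * P) = D \<and> coprime D N}
            \<subseteq> {D. D mod N = D \<and> coprime D N} \<times> {B. B mod P = B}"
      using residues_mult_iff[OF assms, of "D mod N" "D div N" for D]
      by (auto simp: coprime_mod_poly_iff mod_mult_div_eq)
  qed
  from sum.reindex_bij_betw[OF this, of f] show ?thesis
    by (simp add: sum.cartesian_product case_prod_unfold)
qed

section \<open>The coefficient functional\<close>

lemma t_coeff_add: "t_coeff M (A + B) = t_coeff M A + t_coeff M B"
  by (simp add: t_coeff_def poly_mod_add_left)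

lemma t_coeff_smult: "t_coeff M (smult c A) = c * t_coeff M A"
  by (simp add: t_coeff_def mod_smult_left)

text \<open>The remainder of \<open>C * A\<close> modulo \<open>C * M\<close> is
  \<open>C * (A mod M)\<close>, and the index read off is the largest degree this product can have,
  so only the top coefficients contribute.\<close>

lemma t_coeff_mult_mult:
  fixes C M A :: "'a::field poly"
  assumes "C \<noteq> 0" "M \<noteq> 0"
  shows "t_coeff (C * M) (C * A) = lead_coeff C * t_coeff M A"
proof (cases "degree M = 0")
  case True
  \<comment> \<open>The right side is 0 by the convention for constant moduli. So is the left:
    \<open>M\<close> is a unit, hence \<open>C * M\<close> divides \<open>C * A\<close>.\<close>
  hence "M dvd A" using assms by (meson is_unit_iff_degree dvd_trans one_dvd unit_imp_dvd)
  with True show ?thesis by (simp add: t_coeff_def mod_mult_mult1)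
next
  case False
  define R where "R = A mod M"
  have R: "degree R \<le> degree M - 1"
    using degree_mod_less[OF assms(2), of A] False by (auto simp: R_def)
  have "coeff (C * R) (degree C + (degree M - 1)) = lead_coeff C * coeff R (degree M - 1)"
  proof (cases "degree R = degree M - 1")
    case True
    thus ?thesis by (metis coeff_mult_degree_sum)
  next
    case False
    hence "degree R < degree M - 1" using R by simp
    moreover from this have "degree (C * R) < degree C + (degree M - 1)"
      using degree_mult_le[of C R] by linarith
    ultimately show ?thesis by (simp add: coeff_eq_0)
  qed
  thus ?thesis using False assms
    by (simp add: t_coeff_def mod_mult_mult1 degree_mult_eq R_def)
qed

section \<open>Permutations of residues and character sums\<close>

text \<open>Cancellation gives injectivity, and an injective self-map of a finite set is onto; no
  inverse modulo \<open>N\<close> has to be constructed.\<close>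

lemma bij_betw_mult_mod:
  fixes N P :: "'a::{field,finite} poly"
  assumes "N \<noteq> 0" "\<And>X. N dvd P * X \<Longrightarrow> N dvd X"
    and "U \<subseteq> {D. D mod N = D}" "(\<lambda>D. (P * D) mod N) ` U \<subseteq> U"
  shows "bij_betw (\<lambda>D. (P * D) mod N) U U"
proof -
  have fin: "finite U" by (rule finite_subset[OF assms(3) finite_residues[OF assms(1)]])
  have inj: "inj_on (\<lambda>D. (P * D) mod N) U"
  proof (rule inj_onI)
    fix x y assume xy: "x \<in> U" "y \<in> U" "(P * x) mod N = (P * y) mod N"
    hence "N dvd P * (x - y)" by (simp add: mod_eq_dvd_iff right_diff_distrib)
    hence "N dvd x - y" by (rule assms(2))
    hence "x mod N = y mod N" by (simp add: mod_eq_dvd_iff)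
    moreover have "x mod N = x" "y mod N = y" using xy(1,2) assms(3) by auto
    ultimately show "x = y" by simp
  qed
  show ?thesis using inj endo_inj_surj[OF fin assms(4) inj] by (simp add: bij_betw_def)
qed

lemma sum_units_mult:
  fixes N P :: "'a::{field,finite} poly" and f :: "'a poly \<Rightarrow> complex"
  assumes "N \<noteq> 0" "irreducible P" "\<not> P dvd N" "\<And>D. f (D mod N) = f D"
  shows "(\<Sum>D | D mod N = D \<and> coprime D N. f (P * D)) = (\<Sum>D | D mod N = D \<and> coprime D N. f D)"
proof -
  have pr: "prime_elem P" using assms(2) by (rule field_poly_irreducible_imp_prime)
  have cancel: "N dvd X" if dvd: "N dvd P * X" for X
  proof -
    obtain Y where Y: "P * X = N * Y" using dvd by (elim dvdE)
    hence "P dvd N * Y" by (metis dvd_triv_left)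
    then obtain Z where "Y = P * Z" using pr assms(3) by (auto simp: prime_elem_dvd_mult_iff)
    hence "P * X = P * (N * Z)" using Y by (simp add: ac_simps)
    thus ?thesis using assms(2) by auto
  qed
  have "bij_betw (\<lambda>D. (P * D) mod N) {D. D mod N = D \<and> coprime D N} {D. D mod N = D \<and> coprime D N}"
    using assms(1-3) by (intro bij_betw_mult_mod[OF assms(1) cancel])
      (auto simp: coprime_mod_poly_iff coprime_mult_left_poly_iff coprime_irreducible_left_iff)
  from sum.reindex_bij_betw[OF this, of f] show ?thesis by (simp add: assms(4))
qed

lemma nontrivial_additive_character_0:
  "nontrivial_additive_character lam \<Longrightarrow> lam 0 = 1"
  unfolding nontrivial_additive_character_def by (metis add_0 mult_cancel_right1)

text \<open>Orthogonality: if \<open>P\<close> divides \<open>G\<close>, every term is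
  \<open>lam 0 = 1\<close>; otherwise translation by a suitable \<open>B0\<close> multiplies the sum
  by a number other than 1.\<close>

lemma sum_E_char_irreducible:
  fixes P :: "'a::{field,finite} poly"
  assumes lam: "nontrivial_additive_character lam" and P: "irreducible P"
  shows "(\<Sum>B | B mod P = B. E_char lam G P B) = (if P dvd G then of_nat (poly_abs P) else 0)"
proof -
  have P0: "P \<noteq> 0" using P by auto
  have deg: "degree P \<noteq> 0" using P P0 by (metis irreducible_not_unit is_unit_iff_degree)
  let ?S = "\<Sum>B | B mod P = B. E_char lam G P B"
  show ?thesis
  proof (cases "P dvd G")
    case True
    hence "E_char lam G P B = 1" for B
      using nontrivial_additive_character_0[OF lam] by (simp add: E_char_def t_coeff_def)
    with True show ?thesis by (simp add: card_residues P0)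
  next
    case False
    obtain a where a: "lam a \<noteq> 1" using lam by (auto simp: nontrivial_additive_character_def)
    have "prime_elem P" using P by (rule field_poly_irreducible_imp_prime)
    hence "bij_betw (\<lambda>D. (G * D) mod P) {D. D mod P = D} {D. D mod P = D}"
      using False P0 by (intro bij_betw_mult_mod) (auto simp: prime_elem_dvd_mult_iff)
    \<comment> \<open>Multiplication by \<open>G\<close> is onto modulo \<open>P\<close>, so some
      \<open>G * B0\<close> is congruent to the monomial on which \<open>t_coeff P\<close> takes the
      value \<open>a\<close>.\<close>
    hence "monom a (degree P - 1) mod P \<in> (\<lambda>D. (G * D) mod P) ` {D. D mod P = D}"
      by (simp add: bij_betw_def)
    then obtain B0 where "(G * B0) mod P = monom a (degree P - 1) mod P" by auto
    also have "\<dots> = monom a (degree P - 1)"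
      by (rule mod_poly_less) (use deg degree_monom_le[of a "degree P - 1"] in linarith)
    finally have B0: "E_char lam G P B0 = lam a" using deg by (simp add: E_char_def t_coeff_def)
    have mult: "E_char lam G P (B0 + B) = lam a * E_char lam G P B" for B
      using lam B0 by (simp add: E_char_def nontrivial_additive_character_def distrib_left t_coeff_add)
    have "bij_betw (\<lambda>B. (B0 + B) mod P) {B. B mod P = B} {B. B mod P = B}"
      by (rule bij_betw_byWitness[where f' = "\<lambda>B. (B - B0) mod P"])
         (auto simp: mod_diff_left_eq mod_add_right_eq)
    from sum.reindex_bij_betw[OF this, of "E_char lam G P"]
    have "?S = lam a * ?S" by (simp add: E_char_mod mult sum_distrib_left)
    with a False show ?thesis by simp
  qed
qed

section \<open>Ramanujan sums of square-free modulus\<close>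

text \<open>The residues coprime to \<open>N * P\<close> are those coprime to \<open>N\<close>
  without the multiples of \<open>P\<close>. The multiples contribute the sum modulo
  \<open>N\<close>; the full set contributes that sum times a complete character sum modulo
  \<open>P\<close>.\<close>

lemma ramanujan_sum_mult_irreducible:
  fixes N P :: "'a::{field,finite} poly"
  assumes lam: "nontrivial_additive_character lam" and P: "irreducible P" "lead_coeff P = 1"
    and N: "lead_coeff N = 1" "\<not> P dvd N"
  shows "ramanujan_sum lam G (N * P) =
           (if P dvd G then of_nat (poly_abs P) - 1 else - 1) * ramanujan_sum lam G N"
proof -
  have nz: "N \<noteq> 0" "P \<noteq> 0" using N P by auto
  let ?f = "E_char lam G (N * P)"
  let ?U = "{D. D mod N = D \<and> coprime D N}"
  let ?A = "{D. D mod (N * P) = D \<and> coprime D N}"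
  have fin: "finite ?A" using nz by (intro finite_subset[OF _ finite_residues[of "N * P"]]) auto
  have cop: "coprime D (N * P) \<longleftrightarrow> coprime D N \<and> \<not> P dvd D" for D
  \<comment> \<open>At 0 both sides are false: \<open>P\<close> divides 0, and \<open>N * P\<close>
    is not a unit.\<close>
  proof (cases "D = 0")
    case True
    have "\<not> P dvd 1" using P(1) by (rule irreducible_not_unit)
    thus ?thesis using True by (auto dest: dvd_mult_right)
  next
    case False
    thus ?thesis using coprime_irreducible_left_iff[OF P(1) False] coprime_mult_left_poly_iff[OF False, of N P]
      by (simp add: coprime_commute)
  qed
  have split: "ramanujan_sum lam G (N * P) = sum ?f ?A - sum ?f {D \<in> ?A. P dvd D}"
  proof -
    have "{D. D mod (N * P) = D \<and> coprime D (N * P)} = ?A - {D \<in> ?A. P dvd D}"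
      by (auto simp: cop)
    thus ?thesis unfolding ramanujan_sum_def using fin by (auto intro: sum_diff)
  qed
  have img: "{D \<in> ?A. P dvd D} = (*) P ` ?U"
  proof (intro equalityI subsetI)
    fix D assume D: "D \<in> {D \<in> ?A. P dvd D}"
    then obtain C where C: "D = P * C" by auto
    have "P * (C mod N) = P * C" using D by (simp add: C mult.commute[of N] mod_mult_mult1)
    with D C nz show "D \<in> (*) P ` ?U" by (auto simp: coprime_mult_left_poly_iff)
  next
    fix D assume "D \<in> (*) P ` ?U"
    then obtain C where C: "D = P * C" "C mod N = C" "coprime C N" by auto
    have "(P * C) mod (N * P) = P * C"
      using C(2) by (simp add: mult.commute[of N] mod_mult_mult1)
    moreover have "coprime (P * C) N"
      using C nz P(1) N(2) by (simp add: coprime_mult_left_poly_iff coprime_irreducible_left_iff)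
    ultimately show "D \<in> {D \<in> ?A. P dvd D}" using C by simp
  qed
  have "sum ?f {D \<in> ?A. P dvd D} = (\<Sum>D\<in>?U. ?f (P * D))"
    unfolding img using nz by (subst sum.reindex) (auto simp: inj_on_def)
  also have "\<dots> = ramanujan_sum lam G N"
    unfolding ramanujan_sum_def
  proof (rule sum.cong)
    fix D
    \<comment> \<open>\<open>P\<close> is monic, so cancelling it introduces no scalar; the same
      holds for \<open>N\<close> further on.\<close>
    have "t_coeff (P * N) (P * (G * D)) = t_coeff N (G * D)" using nz P by (simp add: t_coeff_mult_mult)
    thus "?f (P * D) = E_char lam G N D" by (simp add: E_char_def ac_simps)
  qed simp
  finally have second: "sum ?f {D \<in> ?A. P dvd D} = ramanujan_sum lam G N" .
  have "sum ?f ?A = (\<Sum>D\<in>?U. \<Sum>B | B mod P = B. ?f (D + N * B))"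
    by (rule sum_residues_mult[OF nz])
  \<comment> \<open>By additivity the character splits, and the factor depending on \<open>B\<close>
    is a character modulo \<open>P\<close> alone.\<close>
  also have "\<dots> = (\<Sum>D\<in>?U. ?f D * (\<Sum>B | B mod P = B. E_char lam G P B))"
    unfolding sum_distrib_left
  proof (intro sum.cong refl)
    fix D B
    have "t_coeff (N * P) (N * (G * B)) = t_coeff P (G * B)" using nz N by (simp add: t_coeff_mult_mult)
    hence "t_coeff (N * P) (G * (D + N * B)) = t_coeff (N * P) (G * D) + t_coeff P (G * B)"
      by (simp add: distrib_left t_coeff_add mult.left_commute)
    thus "?f (D + N * B) = ?f D * E_char lam G P B"
      using lam by (simp add: E_char_def nontrivial_additive_character_def)
  qed
  also have "\<dots> = (if P dvd G then of_nat (poly_abs P) else 0) * sum ?f ?U"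
    by (simp only: sum_E_char_irreducible[OF lam P(1)] sum_distrib_right[symmetric] mult.commute)
  also have "\<dots> = (if P dvd G then of_nat (poly_abs P) else 0) * ramanujan_sum lam G N"
  proof (cases "P dvd G")
    case True
    \<comment> \<open>Cancelling \<open>P\<close> turns \<open>G\<close> into \<open>K\<close>; the
      substitution of \<open>P * D\<close> for \<open>D\<close>, a permutation of the units modulo
      \<open>N\<close>, turns \<open>K\<close> back into \<open>G\<close>.\<close>
    then obtain K where K: "G = P * K" by auto
    have "t_coeff (P * N) (P * (K * D)) = t_coeff N (K * D)" for D using nz P by (simp add: t_coeff_mult_mult)
    hence "sum ?f ?U = (\<Sum>D\<in>?U. E_char lam K N D)"
      by (simp add: E_char_def K ac_simps)
    also have "\<dots> = (\<Sum>D\<in>?U. E_char lam K N (P * D))"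
      by (rule sum_units_mult[OF nz(1) P(1) N(2), symmetric]) (rule E_char_mod)
    also have "\<dots> = ramanujan_sum lam G N"
      by (simp add: ramanujan_sum_def E_char_def K ac_simps)
    finally show ?thesis by simp
  qed simp
  finally show ?thesis unfolding split second by (simp add: left_diff_distrib)
qed

lemma ramanujan_sum_prod_irreducible:
  fixes S :: "'a::{field,finite} poly set"
  assumes lam: "nontrivial_additive_character lam"
    and "finite S" "\<And>P. P \<in> S \<Longrightarrow> irreducible P \<and> lead_coeff P = 1"
  shows "ramanujan_sum lam G (\<Prod>S) =
           (\<Prod>P\<in>S. if P dvd G then of_nat (poly_abs P) - 1 else - 1)"
  using assms(2,3)
proof (induction S rule: finite_induct)
  case empty
  \<comment> \<open>Modulo 1 the only residue is 0, which is coprime to 1, and its term is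
    \<open>lam 0 = 1\<close>, the empty product.\<close>
  have "{D :: 'a poly. D mod 1 = D \<and> coprime D 1} = {0}" by auto
  thus ?case using nontrivial_additive_character_0[OF lam]
    by (simp add: ramanujan_sum_def E_char_def t_coeff_def)
next
  case (insert P S)
  have "\<not> P dvd \<Prod>S" using insert by (intro monic_irreducible_not_dvd_prod) auto
  moreover have "lead_coeff (\<Prod>S) = 1" using insert.prems by (simp add: lead_coeff_prod)
  ultimately have "ramanujan_sum lam G (\<Prod>S * P) =
      (if P dvd G then of_nat (poly_abs P) - 1 else - 1) * ramanujan_sum lam G (\<Prod>S)"
    using insert.prems by (intro ramanujan_sum_mult_irreducible[OF lam]) auto
  thus ?case using insert by (simp add: mult.commute)
qed

section \<open>Reduction to the square-free kernel\<close>

lemma monic_irreducible_divisors_squarefree_kernel: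
  fixes A :: "'a::{field,finite} poly"
  assumes "A \<noteq> 0"
  shows "monic_irreducible_divisors (squarefree_kernel A) = monic_irreducible_divisors A"
proof (intro equalityI subsetI)
  fix P assume "P \<in> monic_irreducible_divisors A"
  thus "P \<in> monic_irreducible_divisors (squarefree_kernel A)"
    using dvd_prodI[OF finite_monic_irreducible_divisors[OF assms], of P "\<lambda>x. x"]
    by (auto simp: squarefree_kernel_def monic_irreducible_divisors_def)
qed (use squarefree_kernel_dvd[OF assms] in \<open>auto simp: monic_irreducible_divisors_def intro: dvd_trans\<close>)

lemma poly_moebius_squarefree_kernel:
  fixes A :: "'a::{field,finite} poly"
  assumes "A \<noteq> 0"
  shows "poly_moebius (squarefree_kernel A) = (-1) ^ card (monic_irreducible_divisors A)"
proof -
  have "squarefree_kernel A \<noteq> 0" using squarefree_kernel_dvd[OF assms] assms by auto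
  moreover have "\<not> (\<exists>P. irreducible P \<and> P ^ 2 dvd squarefree_kernel A)"
    using squarefree_squarefree_kernel[OF assms] by (auto simp: squarefree_def irreducible_def)
  ultimately show ?thesis
    by (simp add: poly_moebius_def monic_irreducible_divisors_squarefree_kernel[OF assms])
qed

lemma coprime_squarefree_kernel_iff:
  fixes A D :: "'a::{field,finite} poly"
  assumes "A \<noteq> 0"
  shows "coprime D (squarefree_kernel A) \<longleftrightarrow> coprime D A"
proof
  assume cop: "coprime D (squarefree_kernel A)"
  show "coprime D A"
  proof (rule coprimeI, rule ccontr)
    fix C assume C: "C dvd D" "C dvd A" "\<not> C dvd 1"
    hence "C \<noteq> 0" using assms by auto
    then obtain P where P: "irreducible P" "lead_coeff P = 1" "P dvd C"
      using C(3) monic_irreducible_divisor_exists by blast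
    hence "P \<in> monic_irreducible_divisors A"
      using C by (auto simp: monic_irreducible_divisors_def intro: dvd_trans)
    hence "P dvd squarefree_kernel A"
      using monic_irreducible_divisors_squarefree_kernel[OF assms]
      by (auto simp: monic_irreducible_divisors_def)
    moreover have "P dvd D" using P C by (blast intro: dvd_trans)
    ultimately have "P dvd 1" using cop by (blast intro: coprime_common_divisor)
    with P show False by (simp add: irreducible_def)
  qed
next
  assume "coprime D A"
  thus "coprime D (squarefree_kernel A)"
    using squarefree_kernel_dvd[OF assms] by (auto intro: coprimeI dvd_trans dest: coprime_common_divisor)
qed

text \<open>Cancelling the cofactor leaves its leading coefficient, which is moved into the first
  argument since \<open>H\<close> need not be monic. The terms then depend only on \<open>D\<close>
  modulo the kernel, as does coprimality to \<open>H\<close>, and each class has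
  \<open>poly_abs (kernel_cofactor H)\<close> lifts.\<close>

lemma ramanujan_sum_kernel_cofactor:
  fixes G H :: "'a::{field,finite} poly"
  assumes "H \<noteq> 0"
  shows "ramanujan_sum lam (G * kernel_cofactor H) H =
           of_nat (poly_abs (kernel_cofactor H)) *
           ramanujan_sum lam (smult (lead_coeff (kernel_cofactor H)) G) (squarefree_kernel H)"
proof -
  define N K where "N = squarefree_kernel H" and "K = kernel_cofactor H"
  have H: "H = N * K"
    using squarefree_kernel_dvd[OF assms] by (simp add: N_def K_def kernel_cofactor_def)
  hence nz: "N \<noteq> 0" "K \<noteq> 0" using assms by auto
  have cop: "coprime D H \<longleftrightarrow> coprime D N" for D
    unfolding N_def by (rule coprime_squarefree_kernel_iff[OF assms, symmetric])
  have E: "E_char lam (G * K) H D = E_char lam (smult (lead_coeff K) G) N D" for D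
    using t_coeff_mult_mult[OF nz(2,1), of "G * D"]
    by (simp add: E_char_def H ac_simps t_coeff_smult)
  have "ramanujan_sum lam (G * K) H =
      (\<Sum>D | D mod (N * K) = D \<and> coprime D N. E_char lam (smult (lead_coeff K) G) N D)"
    unfolding ramanujan_sum_def E cop by (simp only: H[symmetric])
  also have "\<dots> = (\<Sum>D | D mod N = D \<and> coprime D N. \<Sum>B | B mod K = B.
                    E_char lam (smult (lead_coeff K) G) N (D + N * B))"
    by (rule sum_residues_mult[OF nz])
  also have "\<dots> = (\<Sum>D | D mod N = D \<and> coprime D N. \<Sum>B | B mod K = B.
                    E_char lam (smult (lead_coeff K) G) N D)"
    by (intro sum.cong refl) (metis E_char_mod mod_mult_self2)
  also have "\<dots> = of_nat (poly_abs K) * ramanujan_sum lam (smult (lead_coeff K) G) N"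
    by (simp add: card_residues[OF nz(2)] ramanujan_sum_def sum_distrib_left)
  finally show ?thesis by (simp add: N_def K_def)
qed

lemma normalized_ramanujan_sum_eq_prod:
  fixes G H :: "'a::{field,finite} poly"
  assumes lam: "nontrivial_additive_character lam" and H: "H \<noteq> 0"
  shows "of_int (poly_moebius (squarefree_kernel H)) * ramanujan_sum lam (G * kernel_cofactor H) H
           / of_nat (poly_abs (kernel_cofactor H)) =
         (\<Prod>P\<in>monic_irreducible_divisors H \<inter> monic_irreducible_divisors G. 1 - of_nat (poly_abs P))"
proof -
  let ?S = "monic_irreducible_divisors H"
  let ?c = "lead_coeff (kernel_cofactor H)"
  have fin: "finite ?S" by (rule finite_monic_irreducible_divisors[OF H])
  have K: "kernel_cofactor H \<noteq> 0"
    using squarefree_kernel_dvd[OF H] H by (auto simp: kernel_cofactor_def dvd_div_eq_0_iff)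
  \<comment> \<open>The scalar \<open>?c\<close> is a nonzero constant, so it does not affect which
    \<open>P\<close> divide the first argument.\<close>
  have "ramanujan_sum lam (smult ?c G) (squarefree_kernel H) =
          (\<Prod>P\<in>?S. if P dvd G then of_nat (poly_abs P) - 1 else - 1)"
    unfolding squarefree_kernel_def using K
    by (subst ramanujan_sum_prod_irreducible[OF lam fin])
       (auto simp: monic_irreducible_divisors_def dvd_smult_iff intro!: prod.cong)
  \<comment> \<open>The Moebius value supplies one sign for each \<open>P\<close>. It turns the
    factor -1 of a \<open>P\<close> not dividing \<open>G\<close> into 1, so only common divisors
    remain.\<close>
  hence "of_int (poly_moebius (squarefree_kernel H)) * ramanujan_sum lam (smult ?c G) (squarefree_kernel H)
      = (\<Prod>P\<in>?S. (- 1) * (if P dvd G then of_nat (poly_abs P) - 1 else - 1))"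
    by (simp only: prod.distrib poly_moebius_squarefree_kernel[OF H] prod_constant) simp
  also have "\<dots> = (\<Prod>P\<in>?S. if P \<in> monic_irreducible_divisors G then 1 - of_nat (poly_abs P) else 1)"
    by (rule prod.cong) (auto simp: monic_irreducible_divisors_def)
  also have "\<dots> = (\<Prod>P\<in>?S \<inter> monic_irreducible_divisors G. 1 - of_nat (poly_abs P))"
    using fin by (simp add: prod.inter_restrict)
  finally show ?thesis using K
    by (simp add: ramanujan_sum_kernel_cofactor[OF H] poly_abs_def field_simps)
qed

theorem theorem3p1:
  fixes lam :: "'a::{field,finite} \<Rightarrow> complex" and G H :: "'a poly"
  assumes "nontrivial_additive_character lam"
    and "G \<noteq> 0" and "H \<noteq> 0"
  shows "of_int (poly_moebius (squarefree_kernel H)) * ramanujan_sum lam (G * kernel_cofactor H) H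
           / of_nat (poly_abs (kernel_cofactor H))
       = of_int (poly_moebius (squarefree_kernel G)) * ramanujan_sum lam (H * kernel_cofactor G) G
           / of_nat (poly_abs (kernel_cofactor G))"
  unfolding normalized_ramanujan_sum_eq_prod[OF assms(1,3)] normalized_ramanujan_sum_eq_prod[OF assms(1,2)]
  by (simp only: Int_commute)

end
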